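(* The set $\mathcal{T}=\{t(\mathbf{k}) : \mathbf{k} \text{ a (nonempty) admissible multi-index}\}$, ordered by $\geq$, is a well-ordered set (i.e. it is totally ordered and every nonempty subset has a largest element with respect to the usual order of $\mathbb{R}$), and $t(2)$ is its maximum element.
   Context: An admissible multi-index is a finite sequence $\mathbf{k}=(k_1,\ldots,k_d)$, $d\ge1$, of positive integers with $k_1>1$. The multiple $t$-value is $t(\mathbf{k})=\sum_{m_1>\cdots>m_d>0}\prod_{i=1}^d (2m_i-1)^{-k_i}$. *)

theory Defs
  imports "HOL-Analysis.Analysis"
begin

text \<open>A multi-index is a list of natural numbers; its first entry, called \<open>k\<^sub>1\<close> in the
  literature, is \<open>hd k = k ! 0\<close>.\<close>

definition admissible :: "nat list \<Rightarrow> bool" where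
  "admissible k \<longleftrightarrow> k \<noteq> [] \<and> (\<forall>i<length k. k ! i > 0) \<and> hd k > 1"

definition decreasing_tuples :: "nat \<Rightarrow> nat list set" where
  "decreasing_tuples d = {m. length m = d \<and> sorted_wrt (>) m \<and> (\<forall>i<d. m ! i > 0)}"

text \<open>All terms are positive, so the multiple series is an unordered sum.  It converges for every
  admissible \<open>k\<close>; otherwise \<^const>\<open>infsum\<close> may return its default value 0.\<close>

definition multiple_t :: "nat list \<Rightarrow> real" where
  "multiple_t k =
     (\<Sum>\<^sub>\<infinity>m\<in>decreasing_tuples (length k). \<Prod>i<length k. 1 / (2 * real (m ! i) - 1) ^ (k ! i))"

definition t_values :: "real set" where
  "t_values = {multiple_t k | k. admissible k}"

text \<open>The order \<open>\<ge>\<close> on a set of reals as a relation: \<open>x\<close> comes before \<open>y\<close> iff \<open>x \<ge> y\<close>, so the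
  first element of a subset with respect to this relation is its largest element.\<close>

definition ge_rel :: "real set \<Rightarrow> (real \<times> real) set" where
  "ge_rel A = {(x, y). x \<in> A \<and> y \<in> A \<and> x \<ge> y}"

end

theory Submission
  imports Defs
begin

text \<open>With \<open>y = 11/10\<close>, the generating function of elementary symmetric polynomials bounds the sum
  over the inner indices \<open>m\<^sub>2 > \<dots> > m\<^sub>d\<close> below \<open>m\<^sub>1\<close> by
  \<open>P\<^bsub>m\<^sub>1\<^esub> / y\<^bsup>d-1\<^esup>\<close>, where \<open>P\<^bsub>N\<^esub>\<close> is the product of \<open>1 + y / (2 j - 1)\<close> over \<open>1 \<le> j < N\<close>, and
  the sum of \<open>P\<^bsub>m\<^esub> / (2 m - 1)\<^sup>2\<close> over \<open>m \<ge> 2\<close> is dominated by a telescoping one.  Hence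
  \<open>t(k) \<le> 7/6 (10/11)\<^bsup>d-1\<^esup>\<close> in depth \<open>d \<ge> 2\<close>, which is below \<open>1 + 1/9 \<le> t(2)\<close>.  It also shows that
  the values above a given positive bound have bounded depth.  In a fixed depth \<open>t\<close> is antitone in
  the exponents, so by Dickson's lemma no sequence of values is strictly increasing.\<close>

section \<open>Truncated sums\<close>

definition t_term :: "nat list \<Rightarrow> nat list \<Rightarrow> real" where
  "t_term k m = (\<Prod>i<length k. 1 / (2 * real (m ! i) - 1) ^ (k ! i))"

definition tuples_below :: "nat \<Rightarrow> nat \<Rightarrow> nat list set" where
  "tuples_below d N = {m \<in> decreasing_tuples d. \<forall>x\<in>set m. x < N}"

definition trunc_t :: "nat list \<Rightarrow> nat \<Rightarrow> real" where
  "trunc_t k N = (\<Sum>m\<in>tuples_below (length k) N. t_term k m)"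

text \<open>As a polynomial in \<open>y\<close>, its coefficient of \<open>y ^ d\<close> is the
  truncated sum of depth \<open>d\<close> with all exponents equal to 1.\<close>

definition odd_prod :: "real \<Rightarrow> nat \<Rightarrow> real" where
  "odd_prod y N = (\<Prod>j=1..<N. 1 + y / (2 * real j - 1))"

lemma multiple_t_eq: "multiple_t k = (\<Sum>\<^sub>\<infinity>m\<in>decreasing_tuples (length k). t_term k m)"
  by (simp add: multiple_t_def t_term_def)

lemma t_term_pos:
  assumes "m \<in> decreasing_tuples (length k)"
  shows "t_term k m > 0"
  unfolding t_term_def
proof (rule prod_pos)
  fix i assume "i \<in> {..<length k}"
  then have "m ! i > 0" using assms by (simp add: decreasing_tuples_def)
  then show "0 < 1 / (2 * real (m ! i) - 1) ^ (k ! i)" by simp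
qed

lemma t_term_antimono:
  assumes "m \<in> decreasing_tuples (length k)" "length k' = length k"
    and "\<And>i. i < length k \<Longrightarrow> k ! i \<le> k' ! i"
  shows "t_term k' m \<le> t_term k m"
  unfolding t_term_def assms(2)
proof (rule prod_mono, intro conjI)
  fix i assume i: "i \<in> {..<length k}"
  then have "m ! i > 0" using assms by (simp add: decreasing_tuples_def)
  then have ge1: "2 * real (m ! i) - 1 \<ge> 1" by simp
  then show "0 \<le> 1 / (2 * real (m ! i) - 1) ^ (k' ! i)" by simp
  have "(2 * real (m ! i) - 1) ^ (k ! i) \<le> (2 * real (m ! i) - 1) ^ (k' ! i)"
    using i assms(3) ge1 by (intro power_increasing) auto
  then show "1 / (2 * real (m ! i) - 1) ^ (k' ! i) \<le> 1 / (2 * real (m ! i) - 1) ^ (k ! i)"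
    using ge1 by (intro divide_left_mono) auto
qed

lemma t_term_Cons: "t_term (k # ks) (m # ms) = 1 / (2 * real m - 1) ^ k * t_term ks ms"
  unfolding t_term_def by (simp add: prod.lessThan_Suc_shift del: prod.lessThan_Suc)

lemma Cons_in_decreasing_tuples:
  "m # ms \<in> decreasing_tuples (Suc d) \<longleftrightarrow>
     ms \<in> decreasing_tuples d \<and> (\<forall>x\<in>set ms. x < m) \<and> m > 0"
  by (auto simp: decreasing_tuples_def All_less_Suc2)

lemma finite_tuples_below: "finite (tuples_below d N)"
proof (rule finite_subset)
  show "tuples_below d N \<subseteq> {m. set m \<subseteq> {..<N} \<and> length m = d}"
    by (auto simp: tuples_below_def decreasing_tuples_def)
  show "finite {m. set m \<subseteq> {..<N} \<and> length m = d}"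
    by (rule finite_lists_length_eq) simp
qed

text \<open>Tuples are split by whether their first, hence largest, entry is \<open>N\<close>;
  \<open>N \<ge> 1\<close> keeps that entry positive.\<close>

lemma tuples_below_Suc_Suc:
  assumes "N \<ge> 1"
  shows "tuples_below (Suc d) (Suc N) = tuples_below (Suc d) N \<union> (#) N ` tuples_below d N"
proof (rule set_eqI)
  fix m :: "nat list"
  show "m \<in> tuples_below (Suc d) (Suc N)
      \<longleftrightarrow> m \<in> tuples_below (Suc d) N \<union> (#) N ` tuples_below d N"
  proof (cases m)
    case Nil
    then show ?thesis by (auto simp: tuples_below_def decreasing_tuples_def)
  next
    case (Cons a ms)
    then show ?thesis using assms
      by (auto simp: tuples_below_def Cons_in_decreasing_tuples less_Suc_eq)
  qed
qed

text \<open>This recursion in the cutoff drives the inductive bounds below: raising it by one adds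
  exactly the tuples headed by \<open>N\<close>.\<close>

lemma trunc_t_Cons_Suc:
  assumes "N \<ge> 1"
  shows "trunc_t (k # ks) (Suc N)
    = trunc_t (k # ks) N + 1 / (2 * real N - 1) ^ k * trunc_t ks N"
proof -
  have disj: "tuples_below (Suc (length ks)) N \<inter> (#) N ` tuples_below (length ks) N = {}"
    by (auto simp: tuples_below_def)
  have "trunc_t (k # ks) (Suc N)
    = trunc_t (k # ks) N + (\<Sum>m\<in>(#) N ` tuples_below (length ks) N. t_term (k # ks) m)"
    unfolding trunc_t_def length_Cons tuples_below_Suc_Suc[OF assms]
    using disj by (intro sum.union_disjoint) (auto intro: finite_tuples_below)
  also have "(\<Sum>m\<in>(#) N ` tuples_below (length ks) N. t_term (k # ks) m)
    = 1 / (2 * real N - 1) ^ k * trunc_t ks N"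
    by (simp add: sum.reindex t_term_Cons trunc_t_def sum_distrib_left)
  finally show ?thesis .
qed

lemma trunc_t_Cons_1: "trunc_t (k # ks) (Suc 0) = 0"
proof -
  have "tuples_below (Suc (length ks)) (Suc 0) = {}"
    by (auto simp: tuples_below_def decreasing_tuples_def)
  then show ?thesis by (simp add: trunc_t_def)
qed

lemma trunc_t_Nil: "trunc_t [] N = 1"
proof -
  have "tuples_below 0 N = {[]}"
    by (auto simp: tuples_below_def decreasing_tuples_def)
  then show ?thesis by (simp add: trunc_t_def t_term_def)
qed

section \<open>Bounds for truncated sums\<close>

lemma odd_prod_1 [simp]: "odd_prod y (Suc 0) = 1"
  by (simp add: odd_prod_def)

lemma odd_prod_Suc:
  "N \<ge> 1 \<Longrightarrow> odd_prod y (Suc N) = odd_prod y N * (1 + y / (2 * real N - 1))"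
  by (simp add: odd_prod_def)

lemma odd_prod_pos: "y > 0 \<Longrightarrow> odd_prod y N > 0"
  unfolding odd_prod_def by (rule prod_pos) (auto intro!: add_pos_nonneg)

text \<open>Lowering all exponents to 1 only enlarges the sum, and then a single term of a
  polynomial with nonnegative coefficients is at most its value at \<open>y > 0\<close>. The
  induction runs both recursions in \<open>N\<close> in parallel.\<close>

lemma trunc_t_le_odd_prod:
  assumes "y > 0" "N \<ge> 1" "\<forall>x\<in>set ks. x > 0"
  shows "trunc_t ks N \<le> odd_prod y N / y ^ length ks"
  using assms(2,3)
proof (induction N arbitrary: ks rule: dec_induct)
  case base
  then show ?case using assms(1) by (cases ks) (auto simp: trunc_t_Nil trunc_t_Cons_1)
next
  case (step N)
  have pos: "odd_prod y N > 0" using odd_prod_pos assms(1) .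
  show ?case
  proof (cases ks)
    case Nil
    have "odd_prod y N \<ge> 1" using step.IH[of "[]"] by (simp add: trunc_t_Nil)
    also have "odd_prod y N \<le> odd_prod y (Suc N)"
      using pos step.hyps assms(1) by (simp add: odd_prod_Suc)
    finally show ?thesis using Nil by (simp add: trunc_t_Nil)
  next
    case (Cons k ks')
    have u: "2 * real N - 1 \<ge> 1" using step.hyps by simp
    have "1 / (2 * real N - 1) ^ k \<le> 1 / (2 * real N - 1)"
      using u step.prems Cons self_le_power[of "2 * real N - 1" k]
      by (intro divide_left_mono) auto
    then have "1 / (2 * real N - 1) ^ k * trunc_t ks' N
      \<le> 1 / (2 * real N - 1) * (odd_prod y N / y ^ length ks')"
      using step.IH[of ks'] step.prems Cons u
      by (intro mult_mono)
        (auto simp: trunc_t_def tuples_below_def intro!: sum_nonneg less_imp_le[OF t_term_pos])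
    then have "trunc_t ks (Suc N) \<le> odd_prod y N / y ^ length ks
        + 1 / (2 * real N - 1) * (odd_prod y N / y ^ length ks')"
      using step.IH[of ks] step.prems step.hyps Cons by (simp add: trunc_t_Cons_Suc)
    also have "\<dots> = odd_prod y (Suc N) / y ^ length ks"
      using assms(1) u step.hyps Cons by (simp add: odd_prod_Suc field_simps)
    finally show ?thesis .
  qed
qed

text \<open>With \<open>P\<close> for \<open>odd_prod y\<close>, the quotients
  \<open>P N / (2 N - 2)\<close> drop at each step by at least
  \<open>(2 - y) P N / (2 N - 1) ^ 2\<close>, so the sum over the leading index telescopes from
  \<open>N = 2\<close>, where the quotient is \<open>(1 + y) / 2\<close>.\<close>

lemma trunc_t_admissible_le:
  assumes y: "0 < y" "y < 2" and N: "N \<ge> 2"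
    and k: "k \<ge> 2" "\<forall>x\<in>set ks. x > 0" "ks \<noteq> []"
  shows "trunc_t (k # ks) N
    \<le> ((1 + y) / 2 - odd_prod y N / (2 * real N - 2)) / (2 - y) / y ^ length ks"
  using N
proof (induction N rule: dec_induct)
  case base
  obtain k' ks' where ks: "ks = k' # ks'" using k(3) by (cases ks) auto
  \<comment> \<open>Only the entry 1 lies below 2, and depth at least two needs two distinct
    entries. The right-hand side also starts at 0.\<close>
  have "trunc_t (k # ks) 2 = 0"
    using trunc_t_Cons_Suc[of 1 k ks] by (simp add: ks trunc_t_Cons_1 numeral_2_eq_2)
  moreover have "odd_prod y 2 = 1 + y"
    using odd_prod_Suc[of 1 y] by (simp add: numeral_2_eq_2)
  ultimately show ?case by simp
next
  case (step N)
  define u where "u = 2 * real N - 1"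
  define p where "p = odd_prod y N"
  have u: "u \<ge> 3" using step.hyps by (simp add: u_def)
  have p: "p > 0" unfolding p_def using odd_prod_pos y(1) .
  have "1 / u ^ k * trunc_t ks N \<le> 1 / u ^ 2 * (p / y ^ length ks)"
  proof (rule mult_mono)
    show "1 / u ^ k \<le> 1 / u ^ 2"
      using u k(1) by (intro divide_left_mono power_increasing) auto
    show "trunc_t ks N \<le> p / y ^ length ks"
      unfolding p_def using trunc_t_le_odd_prod y k(2) step.hyps by simp
  qed (use u in \<open>auto simp: trunc_t_def tuples_below_def intro!: sum_nonneg less_imp_le[OF t_term_pos]\<close>)
  also have "1 / u ^ 2 * (p / y ^ length ks)
    \<le> (p / (u - 1) - p * (1 + y / u) / (u + 1)) / (2 - y) / y ^ length ks"
  proof -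
    \<comment> \<open>The exact surplus of the telescoping difference over the required term; its
      sign is clear from \<open>0 < y < 2\<close>.\<close>
    have "p / (u - 1) - p * (1 + y / u) / (u + 1) - (2 - y) * (p / u ^ 2)
      = p * (y * u + (2 - y)) / (u ^ 2 * (u - 1) * (u + 1))"
      using u by (simp add: divide_simps) (simp add: algebra_simps power2_eq_square)
    moreover have "\<dots> \<ge> 0" using u p y by (intro divide_nonneg_pos mult_nonneg_nonneg) auto
    ultimately have "(2 - y) * (p / u ^ 2) \<le> p / (u - 1) - p * (1 + y / u) / (u + 1)" by linarith
    then have "p / u ^ 2 \<le> (p / (u - 1) - p * (1 + y / u) / (u + 1)) / (2 - y)"
      using y by (simp add: pos_le_divide_eq mult.commute)
    then have "p / u ^ 2 / y ^ length ks
      \<le> (p / (u - 1) - p * (1 + y / u) / (u + 1)) / (2 - y) / y ^ length ks"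
      using y by (intro divide_right_mono) auto
    then show ?thesis by simp
  qed
  finally have "trunc_t (k # ks) (Suc N)
    \<le> ((1 + y) / 2 - p / (u - 1)) / (2 - y) / y ^ length ks
      + (p / (u - 1) - p * (1 + y / u) / (u + 1)) / (2 - y) / y ^ length ks"
    using step.IH step.hyps by (simp add: trunc_t_Cons_Suc u_def p_def)
  also have "\<dots> = ((1 + y) / 2 - p * (1 + y / u) / (u + 1)) / (2 - y) / y ^ length ks"
    by (simp flip: add_divide_distrib)
  also have "\<dots> = ((1 + y) / 2 - odd_prod y (Suc N) / (2 * real (Suc N) - 2)) / (2 - y) / y ^ length ks"
    using step.hyps by (simp add: odd_prod_Suc u_def p_def)
  finally show ?case .
qed

text \<open>The term at 1 is split off and the rest telescopes. The bound is crude, as it only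
  serves convergence in depth one.\<close>

lemma trunc_t_single_le:
  assumes "N \<ge> 2" "k \<ge> 2"
  shows "trunc_t [k] N \<le> 2 - 1 / (2 * real N - 2)"
  using assms(1)
proof (induction N rule: dec_induct)
  case base
  show ?case
    using trunc_t_Cons_Suc[of 1 k "[]"] by (simp add: trunc_t_Nil trunc_t_Cons_1 numeral_2_eq_2)
next
  case (step N)
  define u where "u = 2 * real N - 1"
  have u: "u \<ge> 3" using step.hyps by (simp add: u_def)
  have "1 / u ^ k \<le> 1 / u ^ 2"
    using u assms(2) by (intro divide_left_mono power_increasing) auto
  also have "\<dots> \<le> 1 / (u - 1) - 1 / (u + 1)"
    using u by (simp add: divide_simps) (simp add: algebra_simps power2_eq_square)
  finally show ?case
    using step.IH step.hyps by (simp add: trunc_t_Cons_Suc trunc_t_Nil u_def)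
qed

section \<open>Convergence and comparison of multiple t-values\<close>

lemma t_term_finite_sum_le:
  assumes "\<And>N. N \<ge> 2 \<Longrightarrow> trunc_t k N \<le> c"
    and F: "finite F" "F \<subseteq> decreasing_tuples (length k)"
  shows "sum (t_term k) F \<le> c"
proof -
  \<comment> \<open>The inserted 0 makes \<open>Max\<close> meaningful when no entries occur; the
    two successors give strict bounds on the entries and \<open>N \<ge> 2\<close>.\<close>
  define N where "N = Suc (Suc (Max (insert 0 (\<Union>m\<in>F. set m))))"
  have "F \<subseteq> tuples_below (length k) N"
  proof
    fix m assume m: "m \<in> F"
    have "x < N" if "x \<in> set m" for x
    proof -
      have "x \<le> Max (insert 0 (\<Union>m\<in>F. set m))" using m that F(1) by (intro Max_ge) auto
      then show ?thesis by (simp add: N_def)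
    qed
    then show "m \<in> tuples_below (length k) N" using m F(2) by (auto simp: tuples_below_def)
  qed
  then have "sum (t_term k) F \<le> trunc_t k N"
    unfolding trunc_t_def
    by (intro sum_mono2 finite_tuples_below) (auto simp: tuples_below_def intro: less_imp_le[OF t_term_pos])
  also have "\<dots> \<le> c" by (rule assms(1)) (simp add: N_def)
  finally show ?thesis .
qed

text \<open>The terms are positive, so a uniform bound on truncations bounds all finite partial
  sums.\<close>

lemma t_term_summable_le:
  assumes "\<And>N. N \<ge> 2 \<Longrightarrow> trunc_t k N \<le> c"
  shows "t_term k summable_on decreasing_tuples (length k)" "multiple_t k \<le> c"
proof -
  show *: "t_term k summable_on decreasing_tuples (length k)"
    by (intro nonneg_bdd_above_summable_on bdd_aboveI[of _ c])
      (auto intro: less_imp_le[OF t_term_pos] t_term_finite_sum_le[OF assms])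
  show "multiple_t k \<le> c"
    unfolding multiple_t_eq by (rule infsum_le_finite_sums[OF * t_term_finite_sum_le[OF assms]])
qed

lemma admissible_cases:
  assumes "admissible k"
  obtains a ks where "k = a # ks" "a \<ge> 2" "\<forall>x\<in>set ks. x > 0"
proof (cases k)
  case Nil
  then show thesis using assms by (simp add: admissible_def)
next
  case (Cons a ks)
  then show thesis
    using assms by (intro that) (auto simp: admissible_def All_less_Suc2 all_set_conv_all_nth)
qed

lemma multiple_t_depth_bound:
  assumes "admissible k" "length k \<ge> 2"
  shows "t_term k summable_on decreasing_tuples (length k)"
    and "multiple_t k \<le> 7 / 6 * (10 / 11) ^ (length k - 1)"
proof -
  obtain a ks where k: "k = a # ks" "a \<ge> 2" "\<forall>x\<in>set ks. x > 0"
    using admissible_cases assms(1) .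
  have "trunc_t k N \<le> 7 / 6 * (10 / 11) ^ (length k - 1)" if N: "N \<ge> 2" for N
  proof -
    define q where "q = odd_prod (11 / 10) N / (2 * real N - 2)"
    have "q \<ge> 0"
      using N odd_prod_pos[of "11 / 10" N] by (simp add: q_def)
    have "trunc_t k N \<le> ((1 + 11 / 10) / 2 - q) / (2 - 11 / 10) / (11 / 10) ^ length ks"
      unfolding k(1) q_def using N k assms(2) by (intro trunc_t_admissible_le) auto
    also have "\<dots> \<le> ((1 + 11 / 10) / 2) / (2 - 11 / 10) / (11 / 10) ^ length ks"
      using \<open>q \<ge> 0\<close> by (intro divide_right_mono) auto
    \<comment> \<open>The choice \<open>y = 11 / 10\<close> exceeds 1, which gives decay in the
      depth, and stays below 2, as the telescoping requires.\<close>
    also have "\<dots> = 7 / 6 * (10 / 11) ^ length ks"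
      by (simp add: power_divide)
    finally show ?thesis using k(1) by simp
  qed
  from t_term_summable_le[OF this]
  show "t_term k summable_on decreasing_tuples (length k)"
    and "multiple_t k \<le> 7 / 6 * (10 / 11) ^ (length k - 1)" by auto
qed

lemma t_term_summable:
  assumes "admissible k"
  shows "t_term k summable_on decreasing_tuples (length k)"
proof (cases "length k \<ge> 2")
  case True
  then show ?thesis using multiple_t_depth_bound assms by blast
next
  case False
  obtain a ks where k: "k = a # ks" "a \<ge> 2" using admissible_cases assms by metis
  with False have single: "k = [a]" by (cases ks) auto
  have "trunc_t k N \<le> 2" if "N \<ge> 2" for N
  proof -
    have "1 / (2 * real N - 2) \<ge> 0" using that by simp
    then show ?thesis using trunc_t_single_le[OF that k(2)] unfolding single by linarith
  qed
  then show ?thesis by (rule t_term_summable_le)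
qed

text \<open>The comparison is termwise, since every base \<open>2 m - 1\<close> is at least 1.
  Summability of both families excludes the default value of \<open>infsum\<close>.\<close>

lemma multiple_t_antimono:
  assumes "admissible k" "admissible k'" "length k' = length k"
    and "\<And>i. i < length k \<Longrightarrow> k ! i \<le> k' ! i"
  shows "multiple_t k' \<le> multiple_t k"
  unfolding multiple_t_eq assms(3)
  using t_term_summable[OF assms(1)] t_term_summable[OF assms(2)] assms(3,4)
  by (intro infsum_mono t_term_antimono) auto

lemma decreasing_tuples_nonempty: "rev [1..<Suc d] \<in> decreasing_tuples d"
  by (auto simp: decreasing_tuples_def sorted_wrt_rev rev_nth simp del: upt_Suc)

lemma multiple_t_pos:
  assumes "admissible k"
  shows "multiple_t k > 0"
proof -
  define m where "m = rev [1..<Suc (length k)]"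
  have m: "m \<in> decreasing_tuples (length k)" unfolding m_def by (rule decreasing_tuples_nonempty)
  have "0 < sum (t_term k) {m}" using t_term_pos[OF m] by simp
  also have "\<dots> \<le> multiple_t k"
    unfolding multiple_t_eq using m
    by (intro finite_sum_le_infsum t_term_summable assms) (auto intro: less_imp_le[OF t_term_pos])
  finally show ?thesis .
qed

section \<open>The maximum t(2)\<close>

lemma multiple_t_2_ge: "multiple_t [2] \<ge> 10 / 9"
proof -
  have "admissible [2]" by (simp add: admissible_def)
  then have "sum (t_term [2]) {[1], [2]} \<le> multiple_t [2]"
    unfolding multiple_t_eq
    by (intro finite_sum_le_infsum t_term_summable)
      (auto simp: decreasing_tuples_def intro: less_imp_le[OF t_term_pos])
  moreover have "sum (t_term [2]) {[1], [2]} = 10 / 9" by (simp add: t_term_def)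
  ultimately show ?thesis by simp
qed

lemma multiple_t_le_multiple_t_2:
  assumes "admissible k"
  shows "multiple_t k \<le> multiple_t [2]"
proof (cases "length k \<ge> 2")
  case True
  \<comment> \<open>Depth two is the worst case:
    \<open>7 / 6 * 10 / 11 = 35 / 33 < 10 / 9\<close>.\<close>
  have "(10 / 11 :: real) ^ (length k - 1) \<le> (10 / 11) ^ 1"
    using True by (intro power_decreasing) auto
  then show ?thesis
    using multiple_t_depth_bound(2)[OF assms True] multiple_t_2_ge by simp
next
  case False
  obtain a ks where k: "k = a # ks" "a \<ge> 2" using admissible_cases assms by metis
  with False have "k = [a]" by (cases ks) auto
  then show ?thesis using assms k(2)
    by (intro multiple_t_antimono) (auto simp: admissible_def)
qed

section \<open>Well-foundedness\<close>

text \<open>Every sequence has a monotone subsequence, and a decreasing one in the naturals is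
  constant once it attains its minimum.\<close>

lemma nat_mono_subseq:
  fixes f :: "nat \<Rightarrow> nat"
  shows "\<exists>r :: nat \<Rightarrow> nat. strict_mono r \<and> mono (f \<circ> r)"
proof -
  obtain r :: "nat \<Rightarrow> nat" where r: "strict_mono r" "monoseq (\<lambda>n. f (r n))"
    using seq_monosub by blast
  from r(2) consider "incseq (\<lambda>n. f (r n))" | "decseq (\<lambda>n. f (r n))"
    by (auto simp: monoseq_iff)
  then show ?thesis
  proof cases
    case 1
    then show ?thesis using r(1) by (auto simp: comp_def)
  next
    case 2
    obtain n0 where n0: "\<And>n. f (r n0) \<le> f (r n)"
      using ex_has_least_nat[of "\<lambda>_. True" 0 "\<lambda>n. f (r n)"] by auto
    have "f (r (n + n0)) = f (r n0)" for n
      using decseqD[OF 2, of n0 "n + n0"] n0[of "n + n0"] by simp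
    then have "mono (f \<circ> (\<lambda>n. r (n + n0)))" by (simp add: mono_def)
    moreover have "strict_mono (\<lambda>n. r (n + n0))" using r(1) by (simp add: strict_mono_def)
    ultimately show ?thesis by blast
  qed
qed

text \<open>Subsequences are refined one coordinate at a time; passing to a further subsequence
  preserves the monotonicity already gained.\<close>

lemma nat_family_mono_subseq:
  fixes F :: "nat \<Rightarrow> nat \<Rightarrow> nat"
  shows "\<exists>r :: nat \<Rightarrow> nat. strict_mono r \<and> (\<forall>i<n. mono (F i \<circ> r))"
proof (induction n)
  case 0
  show ?case using strict_mono_id by auto
next
  case (Suc n)
  then obtain r :: "nat \<Rightarrow> nat" where r: "strict_mono r" "\<forall>i<n. mono (F i \<circ> r)" by blast
  obtain s :: "nat \<Rightarrow> nat" where s: "strict_mono s" "mono ((F n \<circ> r) \<circ> s)"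
    using nat_mono_subseq by blast
  have "mono (F i \<circ> (r \<circ> s))" if "i < Suc n" for i
  proof (cases "i = n")
    case True
    then show ?thesis using s(2) by (simp add: o_assoc)
  next
    case False
    then have "mono (F i \<circ> r)" using r(2) that by simp
    then have "mono ((F i \<circ> r) \<circ> s)"
      using strict_mono_mono[OF s(1)] by (simp add: mono_def)
    then show ?thesis by (simp add: o_assoc)
  qed
  then show ?case using strict_mono_o[OF r(1) s(1)] by blast
qed

lemma dickson_bounded_length:
  fixes k :: "nat \<Rightarrow> nat list"
  assumes "\<And>n. length (k n) \<le> D"
  obtains i j where "i < j" "length (k j) = length (k i)"
    "\<And>l. l < length (k i) \<Longrightarrow> k i ! l \<le> k j ! l"
proof -
  \<comment> \<open>Monotonicity of both the length and its complement in \<open>D\<close> forces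
    equal lengths. The other \<open>D\<close> coordinates are the entries, read only at positions
    inside the lists.\<close>
  define F where "F l n = (if l = 0 then length (k n)
    else if l = 1 then D - length (k n) else k n ! (l - 2))" for l n
  obtain r :: "nat \<Rightarrow> nat" where r: "strict_mono r" "\<forall>l<D + 2. mono (F l \<circ> r)"
    using nat_family_mono_subseq by blast
  have F: "F l (r 0) \<le> F l (r 1)" if "l < D + 2" for l
    using r(2) that by (auto simp: mono_def)
  show ?thesis
  proof
    show "r 0 < r 1" using r(1) by (simp add: strict_mono_less)
    show "length (k (r 1)) = length (k (r 0))"
      using F[of 0] F[of 1] assms[of "r 0"] assms[of "r 1"] by (simp add: F_def)
    show "k (r 0) ! l \<le> k (r 1) ! l" if "l < length (k (r 0))" for l
      using F[of "l + 2"] that assms[of "r 0"] by (simp add: F_def)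
  qed
qed

section \<open>Largest elements and the well-order\<close>

lemma t_values_has_max:
  assumes "S \<subseteq> t_values" "S \<noteq> {}"
  shows "\<exists>x\<in>S. \<forall>y\<in>S. y \<le> x"
proof (rule ccontr)
  assume "\<not> ?thesis"
  then have next_larger: "\<exists>y\<in>S. x < y" if "x \<in> S" for x using that by (meson not_le)
  obtain f :: "nat \<Rightarrow> real" where f: "\<And>n. f n \<in> S" "\<And>n. f n < f (Suc n)"
    using dependent_nat_choice[of "\<lambda>_ x. x \<in> S" "\<lambda>_ x y. x < y"] assms(2) next_larger by blast
  have f_mono: "strict_mono f" using f(2) by (simp add: strict_mono_Suc_iff)
  have "\<forall>n. \<exists>k. admissible k \<and> f n = multiple_t k"
    using f(1) assms(1) by (auto simp: t_values_def)
  then obtain k where k: "\<And>n. admissible (k n)" "\<And>n. f n = multiple_t (k n)" by metis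
  have "f 0 > 0" using k multiple_t_pos by simp
  \<comment> \<open>The whole sequence stays above \<open>f 0 > 0\<close>, so depths at which the
    geometric bound falls below \<open>f 0\<close> cannot occur.\<close>
  then obtain D where D: "(10 / 11 :: real) ^ D < 6 / 7 * f 0"
    using real_arch_pow_inv[of "6 / 7 * f 0" "10 / 11"] by auto
  have "length (k n) \<le> D + 1" for n
  proof (rule ccontr)
    assume "\<not> length (k n) \<le> D + 1"
    then have len: "length (k n) \<ge> 2" "D \<le> length (k n) - 1" by auto
    have "f 0 \<le> f n" using f_mono by (simp add: strict_mono_less_eq)
    also have "\<dots> \<le> 7 / 6 * (10 / 11) ^ (length (k n) - 1)"
      unfolding k(2) using multiple_t_depth_bound(2) k(1) len(1) by blast
    also have "\<dots> \<le> 7 / 6 * (10 / 11) ^ D"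
      using len(2) by (intro mult_left_mono power_decreasing) auto
    finally show False using D by simp
  qed
  then obtain i j where "i < j" "length (k j) = length (k i)"
    "\<And>l. l < length (k i) \<Longrightarrow> k i ! l \<le> k j ! l"
    using dickson_bounded_length by blast
  \<comment> \<open>Larger exponents at equal depth give a smaller value, against the strict
    increase of \<open>f\<close>.\<close>
  then have "f j \<le> f i" unfolding k(2) using k(1) by (intro multiple_t_antimono) auto
  then show False using f_mono \<open>i < j\<close> by (meson not_le strict_monoD)
qed

lemma well_order_on_ge_rel:
  assumes "\<And>S. S \<subseteq> A \<Longrightarrow> S \<noteq> {} \<Longrightarrow> \<exists>x\<in>S. \<forall>y\<in>S. y \<le> x"
  shows "well_order_on A (ge_rel A)"
  unfolding well_order_on_def
proof
  show "linear_order_on A (ge_rel A)"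
    by (auto simp: order_on_defs ge_rel_def refl_on_def trans_def antisym_def total_on_def)
  show "wf (ge_rel A - Id)"
  proof (rule wfI_min)
    fix x :: real and Q assume "x \<in> Q"
    show "\<exists>z\<in>Q. \<forall>y. (y, z) \<in> ge_rel A - Id \<longrightarrow> y \<notin> Q"
    \<comment> \<open>Here \<open>Q\<close> is an arbitrary set of reals: outside \<open>A\<close>
      nothing has predecessors, and inside \<open>A\<close> a minimal element is a largest
      one.\<close>
    proof (cases "Q \<inter> A = {}")
      case True
      then show ?thesis using \<open>x \<in> Q\<close> by (auto simp: ge_rel_def)
    next
      case False
      then obtain z where "z \<in> Q \<inter> A" "\<forall>y\<in>Q \<inter> A. y \<le> z" using assms[of "Q \<inter> A"] by auto
      then have "(y, z) \<in> ge_rel A - Id \<longrightarrow> y \<notin> Q" for y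
        by (force simp: ge_rel_def)
      then show ?thesis using \<open>z \<in> Q \<inter> A\<close> by blast
    qed
  qed
qed

theorem theorem1p2:
  shows "well_order_on t_values (ge_rel t_values)
    \<and> (\<forall>S. S \<subseteq> t_values \<and> S \<noteq> {} \<longrightarrow> (\<exists>x\<in>S. \<forall>y\<in>S. y \<le> x))
    \<and> multiple_t [2] \<in> t_values
    \<and> (\<forall>x\<in>t_values. x \<le> multiple_t [2])"
proof (intro conjI)
  show "well_order_on t_values (ge_rel t_values)"
    by (rule well_order_on_ge_rel) (rule t_values_has_max)
  show "\<forall>S. S \<subseteq> t_values \<and> S \<noteq> {} \<longrightarrow> (\<exists>x\<in>S. \<forall>y\<in>S. y \<le> x)"
    using t_values_has_max by blast
  have "admissible [2]" by (simp add: admissible_def)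
  then show "multiple_t [2] \<in> t_values" unfolding t_values_def by blast
  show "\<forall>x\<in>t_values. x \<le> multiple_t [2]"
    using multiple_t_le_multiple_t_2 by (auto simp: t_values_def)
qed

end
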